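(* Let $\Gamma$ be a right-angled Coxeter graph with no vertices of degree zero. Then $$A[\Gamma][4]=\ker\bigl(A[\Gamma]\to W[\Gamma]/W[\Gamma]'\bigr),$$ where $W[\Gamma]$ is the corresponding right-angled Coxeter group, $W[\Gamma]'$ is its commutator subgroup, and the map is the composition of the natural projection $\pi:A[\Gamma]\to W[\Gamma]$ with the abelianisation map of $W[\Gamma]$.
   Context: A right-angled Coxeter graph $\Gamma$ on vertices $1,\dots,n$ is given by a symmetric matrix $(m_{i,j})$ with $m_{i,i}=1$ and $m_{i,j}\in\{2,\infty\}$ for $i\neq j$; vertices $i\ne j$ are joined by an edge if and only if $m_{i,j}=\infty$. The corresponding right-angled Coxeter group is $W[\Gamma]=\langle w_1,\dots,w_n\mid w_i^2=1,\ w_iw_j=w_jw_i \text{ if } m_{i,j}=2\rangle$, and the right-angled Artin group is $A[\Gamma]=\langle a_1,\dots,a_n\mid a_ia_j=a_ja_i\text{ if } m_{i,j}=2\rangle$; $\pi$ sends $a_i\mapsto w_i$. The integral generalised Burau representation $\tilde\sigma:A[\Gamma]\to\mathrm{GL}(n,\mathbb{Z})$ is defined on the basis $e_1,\dots,e_n$ by $\tilde\sigma(a_i)(e_j)=e_j-\langle e_i,e_j\rangle e_i$, where $\langle e_i,e_j\rangle=-2$ if $m_{i,j}=\infty$ and $i<j$, $\langle e_i,e_j\rangle=2$ if $m_{i,j}=\infty$ and $i>j$, and $\langle e_i,e_j\rangle=0$ if $m_{i,j}=2$ or $i=j$. $A[\Gamma][4]$ is the kernel of $A[\Gamma]\xrightarrow{\tilde\sigma}\mathrm{GL}(n,\mathbb{Z})\to\mathrm{GL}(n,\mathbb{Z}/4)$.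 *)

theory Defs
  imports
    "HOL-Algebra.Generated_Groups"
    "HOL-Library.Extended_Nat"
    "HOL-Library.Numeral_Type"
    "Jordan_Normal_Form.Matrix"
begin

section \<open>Groups given by generators and relations\<close>

text \<open>A letter \<open>(s, True)\<close> stands for the generator \<open>s\<close>, and \<open>(s, False)\<close> for its formal inverse.
  A relation \<open>x = y\<close> is the pair \<open>(x, y)\<close> of words.\<close>

type_synonym 'a word = "('a \<times> bool) list"

abbreviation words :: "'a set \<Rightarrow> 'a word set" where
  "words S \<equiv> lists (S \<times> UNIV)"

inductive_set word_rel :: "'a set \<Rightarrow> ('a word \<times> 'a word) set \<Rightarrow> ('a word \<times> 'a word) set"
  for S R where
    refl: "x \<in> words S \<Longrightarrow> (x, x) \<in> word_rel S R"
  | sym: "(x, y) \<in> word_rel S R \<Longrightarrow> (y, x) \<in> word_rel S R"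
  | trans: "(x, y) \<in> word_rel S R \<Longrightarrow> (y, z) \<in> word_rel S R \<Longrightarrow> (x, z) \<in> word_rel S R"
  | cancel: "u \<in> words S \<Longrightarrow> v \<in> words S \<Longrightarrow> s \<in> S \<Longrightarrow>
      (u @ [(s, b), (s, \<not> b)] @ v, u @ v) \<in> word_rel S R"
  | relation: "u \<in> words S \<Longrightarrow> v \<in> words S \<Longrightarrow> (x, y) \<in> R \<Longrightarrow> x \<in> words S \<Longrightarrow> y \<in> words S \<Longrightarrow>
      (u @ x @ v, u @ y @ v) \<in> word_rel S R"

definition presented_group :: "'a set \<Rightarrow> ('a word \<times> 'a word) set \<Rightarrow> 'a word set monoid" where
  "presented_group S R =
     \<lparr>carrier = words S // word_rel S R,
      monoid.mult = (\<lambda>X Y. \<Union>x\<in>X. \<Union>y\<in>Y. word_rel S R `` {x @ y}),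
      one = word_rel S R `` {[]}\<rparr>"

definition pres_gen :: "'a set \<Rightarrow> ('a word \<times> 'a word) set \<Rightarrow> 'a \<Rightarrow> 'a word set" where
  "pres_gen S R s = word_rel S R `` {[(s, True)]}"

lemma word_rel_in_words: "(x, y) \<in> word_rel S R \<Longrightarrow> x \<in> words S \<and> y \<in> words S"
  by (induction rule: word_rel.induct) auto

lemma word_rel_equiv: "equiv (words S) (word_rel S R)"
  by (intro equivI refl_onI symI transI subsetI)
    (auto dest: word_rel_in_words intro: word_rel.intros)

lemma word_rel_append:
  assumes "(x, y) \<in> word_rel S R" "u \<in> words S" "v \<in> words S"
  shows "(u @ x @ v, u @ y @ v) \<in> word_rel S R"
  using assms
proof (induction rule: word_rel.induct)
  case (refl x)
  then show ?case by (intro word_rel.refl) auto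
next
  case (sym x y)
  then show ?case by (blast intro: word_rel.sym)
next
  case (trans x y z)
  then show ?case by (blast intro: word_rel.trans)
next
  case (cancel u' v' s b)
  then show ?case
    using word_rel.cancel[of "u @ u'" S "v' @ v" s b R] by simp
next
  case (relation u' v' x y)
  then show ?case
    using word_rel.relation[of "u @ u'" S "v' @ v" x y R] by simp
qed

lemma word_rel_append2:
  assumes "(x, x') \<in> word_rel S R" "(y, y') \<in> word_rel S R"
  shows "(x @ y, x' @ y') \<in> word_rel S R"
proof -
  have "x \<in> words S" "y' \<in> words S"
    using assms word_rel_in_words by blast+
  then have "(x @ y, x @ y') \<in> word_rel S R" "(x @ y', x' @ y') \<in> word_rel S R"
    using word_rel_append[OF assms(2), of x "[]"] word_rel_append[OF assms(1), of "[]" y'] by auto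
  then show ?thesis
    by (rule word_rel.trans)
qed

lemma presented_group_mult:
  assumes "x \<in> words S" "y \<in> words S"
  shows "(word_rel S R `` {x}) \<otimes>\<^bsub>presented_group S R\<^esub> (word_rel S R `` {y})
    = word_rel S R `` {x @ y}"
proof -
  have "word_rel S R `` {x' @ y'} = word_rel S R `` {x @ y}"
    if "(x, x') \<in> word_rel S R" "(y, y') \<in> word_rel S R" for x' y'
    using equiv_class_eq[OF word_rel_equiv word_rel_append2[OF that]] by simp
  moreover have "x \<in> word_rel S R `` {x}" "y \<in> word_rel S R `` {y}"
    using assms by (auto intro: word_rel.refl)
  ultimately have "(\<Union>x'\<in>word_rel S R `` {x}. \<Union>y'\<in>word_rel S R `` {y}. word_rel S R `` {x' @ y'})
      = word_rel S R `` {x @ y}"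
    by blast
  then show ?thesis
    by (simp add: presented_group_def)
qed

lemma presented_group_carrier:
  "X \<in> carrier (presented_group S R) \<longleftrightarrow> (\<exists>x\<in>words S. X = word_rel S R `` {x})"
  by (auto simp: presented_group_def quotient_def)

lemma presented_group_one: "\<one>\<^bsub>presented_group S R\<^esub> = word_rel S R `` {[]}"
  by (simp add: presented_group_def)

lemma word_rel_inverse:
  "x \<in> words S \<Longrightarrow> (map (\<lambda>(s, b). (s, \<not> b)) (rev x) @ x, []) \<in> word_rel S R"
proof (induction x)
  case Nil
  then show ?case by (auto intro: word_rel.refl)
next
  case (Cons a x)
  obtain s b where a: "a = (s, b)" by force
  let ?i = "map (\<lambda>(s, b). (s, \<not> b)) (rev x)"
  have "?i \<in> words S" "x \<in> words S" "s \<in> S"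
    using Cons.prems a by (auto simp: in_lists_conv_set)
  from word_rel.cancel[OF this, of "\<not> b" R]
  have "(?i @ [(s, \<not> b), (s, b)] @ x, ?i @ x) \<in> word_rel S R"
    by simp
  moreover have "(?i @ x, []) \<in> word_rel S R"
    using Cons by simp
  ultimately have "(?i @ [(s, \<not> b), (s, b)] @ x, []) \<in> word_rel S R"
    by (rule word_rel.trans)
  then show ?case
    using a by simp
qed

lemma presented_group_is_group: "group (presented_group S R)"
proof (rule groupI)
  fix X assume "X \<in> carrier (presented_group S R)"
  then obtain x where x: "x \<in> words S" "X = word_rel S R `` {x}"
    by (auto simp: presented_group_carrier)
  let ?i = "map (\<lambda>(s, b). (s, \<not> b)) (rev x)"
  have i: "?i \<in> words S"
    using x by (auto simp: in_lists_conv_set)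
  have "(word_rel S R `` {?i}) \<otimes>\<^bsub>presented_group S R\<^esub> X = \<one>\<^bsub>presented_group S R\<^esub>"
    using equiv_class_eq[OF word_rel_equiv word_rel_inverse[OF x(1)]] x i
    by (simp add: presented_group_mult presented_group_one)
  moreover have "word_rel S R `` {?i} \<in> carrier (presented_group S R)"
    using i presented_group_carrier by blast
  ultimately show "\<exists>Y\<in>carrier (presented_group S R). Y \<otimes>\<^bsub>presented_group S R\<^esub> X = \<one>\<^bsub>presented_group S R\<^esub>"
    by blast
next
  fix X Y Z assume "X \<in> carrier (presented_group S R)" "Y \<in> carrier (presented_group S R)"
    "Z \<in> carrier (presented_group S R)"
  then obtain x y z where
    *: "x \<in> words S" "X = word_rel S R `` {x}" "y \<in> words S" "Y = word_rel S R `` {y}"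
      "z \<in> words S" "Z = word_rel S R `` {z}"
    by (elim presented_group_carrier[THEN iffD1, THEN bexE])
  moreover have "x @ y \<in> words S" "y @ z \<in> words S"
    using * by (simp_all del: in_lists_conv_set)
  ultimately show "X \<otimes>\<^bsub>presented_group S R\<^esub> Y \<otimes>\<^bsub>presented_group S R\<^esub> Z
      = X \<otimes>\<^bsub>presented_group S R\<^esub> (Y \<otimes>\<^bsub>presented_group S R\<^esub> Z)"
    by (simp only: presented_group_mult append_assoc)
next
  fix X Y assume "X \<in> carrier (presented_group S R)" "Y \<in> carrier (presented_group S R)"
  then obtain x y where
    *: "x \<in> words S" "X = word_rel S R `` {x}" "y \<in> words S" "Y = word_rel S R `` {y}"
    by (elim presented_group_carrier[THEN iffD1, THEN bexE])
  then have "x @ y \<in> words S"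
    by (simp del: in_lists_conv_set)
  with * show "X \<otimes>\<^bsub>presented_group S R\<^esub> Y \<in> carrier (presented_group S R)"
    unfolding presented_group_carrier by (intro bexI[of _ "x @ y"]) (simp_all only: presented_group_mult)
next
  show "\<one>\<^bsub>presented_group S R\<^esub> \<in> carrier (presented_group S R)"
    unfolding presented_group_one presented_group_carrier by blast
next
  fix X assume "X \<in> carrier (presented_group S R)"
  then show "\<one>\<^bsub>presented_group S R\<^esub> \<otimes>\<^bsub>presented_group S R\<^esub> X = X"
    by (elim presented_group_carrier[THEN iffD1, THEN bexE])
      (simp add: presented_group_one presented_group_mult)
qed

definition word_eval :: "('g, 'h) monoid_scheme \<Rightarrow> ('a \<Rightarrow> 'g) \<Rightarrow> 'a word \<Rightarrow> 'g" where
  "word_eval G f w =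
     foldr (\<lambda>(s, b) g. (if b then f s else inv\<^bsub>G\<^esub> (f s)) \<otimes>\<^bsub>G\<^esub> g) w \<one>\<^bsub>G\<^esub>"

text \<open>The homomorphism from a presented group to \<open>G\<close> sending each generator \<open>s\<close> to \<open>f s\<close>. It is
  meaningful when the elements \<open>f s\<close> satisfy the relations, so that evaluation is constant on
  classes of words; see \<open>extend_hom_in_hom\<close> and \<open>extend_hom_gen\<close>.\<close>

definition extend_hom :: "('g, 'h) monoid_scheme \<Rightarrow> ('a \<Rightarrow> 'g) \<Rightarrow> 'a word set \<Rightarrow> 'g" where
  "extend_hom G f X = the_elem (word_eval G f ` X)"

lemma word_eval_closed:
  assumes "group G" "f \<in> S \<rightarrow> carrier G" "x \<in> words S"
  shows "word_eval G f x \<in> carrier G"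
proof -
  interpret group G by fact
  show ?thesis
    using assms(3) by (induction x) (use assms(2) in \<open>auto simp: word_eval_def Pi_iff\<close>)
qed

lemma word_eval_append:
  assumes "group G" "f \<in> S \<rightarrow> carrier G" "x \<in> words S" "y \<in> words S"
  shows "word_eval G f (x @ y) = word_eval G f x \<otimes>\<^bsub>G\<^esub> word_eval G f y"
proof -
  interpret group G by fact
  note c = word_eval_closed[OF assms(1,2)]
  show ?thesis
    using assms(3)
  proof (induction x)
    case Nil
    then show ?case
      using c[OF assms(4)] by (simp add: word_eval_def)
  next
    case (Cons a x)
    have "word_eval G f x \<in> carrier G"
      using c Cons.hyps by blast
    moreover have "f (fst a) \<in> carrier G"
      using Cons.hyps assms(2) by auto
    ultimately show ?case
      using Cons c[OF assms(4)] by (auto simp: word_eval_def m_assoc split: prod.split)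
  qed
qed

lemma word_eval_word_rel:
  assumes G: "group G" and f: "f \<in> S \<rightarrow> carrier G"
    and R: "\<And>x y. (x, y) \<in> R \<Longrightarrow> word_eval G f x = word_eval G f y"
    and xy: "(x, y) \<in> word_rel S R"
  shows "word_eval G f x = word_eval G f y"
  using xy
proof (induction rule: word_rel.induct)
  case (cancel u v s b)
  interpret group G by fact
  have s: "f s \<in> carrier G" using f cancel by auto
  have p: "[(s, b), (s, \<not> b)] \<in> words S" using cancel by auto
  have "word_eval G f [(s, b), (s, \<not> b)] = \<one>\<^bsub>G\<^esub>"
    using s by (auto simp: word_eval_def)
  moreover have "[(s, b), (s, \<not> b)] @ v \<in> words S" using p cancel by auto
  ultimately show ?case
    using cancel p word_eval_append[OF G f] word_eval_closed[OF G f] by (metis l_one)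
next
  case (relation u v x y)
  then have "x @ v \<in> words S" "y @ v \<in> words S" by auto
  then show ?case
    using relation R word_eval_append[OF G f] by metis
qed auto

lemma extend_hom_class:
  assumes "group G" "f \<in> S \<rightarrow> carrier G"
    "\<And>x y. (x, y) \<in> R \<Longrightarrow> word_eval G f x = word_eval G f y" "x \<in> words S"
  shows "extend_hom G f (word_rel S R `` {x}) = word_eval G f x"
proof -
  have "word_eval G f ` (word_rel S R `` {x}) = {word_eval G f x}"
  proof (intro equalityI subsetI)
    fix g assume "g \<in> word_eval G f ` (word_rel S R `` {x})"
    then obtain y where "(x, y) \<in> word_rel S R" "g = word_eval G f y" by blast
    then show "g \<in> {word_eval G f x}"
      using word_eval_word_rel[OF assms(1-3), of R x y] by simp
  qed (use word_rel.refl[OF assms(4), of R] in blast)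
  then show ?thesis
    by (simp add: extend_hom_def)
qed

lemma extend_hom_in_hom:
  assumes "group G" "f \<in> S \<rightarrow> carrier G"
    "\<And>x y. (x, y) \<in> R \<Longrightarrow> word_eval G f x = word_eval G f y"
  shows "extend_hom G f \<in> hom (presented_group S R) G"
proof (rule homI)
  fix X assume "X \<in> carrier (presented_group S R)"
  then obtain x where "x \<in> words S" "X = word_rel S R `` {x}"
    unfolding presented_group_carrier by blast
  then show "extend_hom G f X \<in> carrier G"
    using extend_hom_class[OF assms, where x = x] word_eval_closed[OF assms(1,2), of x] by simp
next
  fix X Y assume "X \<in> carrier (presented_group S R)" "Y \<in> carrier (presented_group S R)"
  then obtain x y where
    "x \<in> words S" "X = word_rel S R `` {x}" "y \<in> words S" "Y = word_rel S R `` {y}"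
    by (auto simp: presented_group_carrier)
  moreover from this have "x @ y \<in> words S" by auto
  ultimately show "extend_hom G f (X \<otimes>\<^bsub>presented_group S R\<^esub> Y) = extend_hom G f X \<otimes>\<^bsub>G\<^esub> extend_hom G f Y"
    using extend_hom_class[OF assms] word_eval_append[OF assms(1,2)]
    by (simp add: presented_group_mult)
qed

lemma extend_hom_gen:
  assumes "group G" "f \<in> S \<rightarrow> carrier G"
    "\<And>x y. (x, y) \<in> R \<Longrightarrow> word_eval G f x = word_eval G f y" "s \<in> S"
  shows "extend_hom G f (pres_gen S R s) = f s"
proof -
  interpret group G by fact
  have "f s \<in> carrier G" using assms by auto
  then show ?thesis
    using extend_hom_class[OF assms(1-3), where x = "[(s, True)]"] assms(4)
    by (simp add: pres_gen_def word_eval_def)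
qed

section \<open>Right-angled Coxeter graphs and their groups\<close>

text \<open>The vertices \<open>1, \<dots>, n\<close> are shifted to \<open>0, \<dots>, n - 1\<close>, matching the indices of matrices.\<close>

definition right_angled_coxeter :: "nat \<Rightarrow> (nat \<Rightarrow> nat \<Rightarrow> enat) \<Rightarrow> bool" where
  "right_angled_coxeter n m \<longleftrightarrow>
     (\<forall>i<n. m i i = 1) \<and>
     (\<forall>i<n. \<forall>j<n. m i j = m j i) \<and>
     (\<forall>i<n. \<forall>j<n. i \<noteq> j \<longrightarrow> m i j = 2 \<or> m i j = \<infinity>)"

definition coxeter_edge :: "(nat \<Rightarrow> nat \<Rightarrow> enat) \<Rightarrow> nat \<Rightarrow> nat \<Rightarrow> bool" where
  "coxeter_edge m i j \<longleftrightarrow> i \<noteq> j \<and> m i j = \<infinity>"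

definition coxeter_degree :: "nat \<Rightarrow> (nat \<Rightarrow> nat \<Rightarrow> enat) \<Rightarrow> nat \<Rightarrow> nat" where
  "coxeter_degree n m i = card {j. j < n \<and> coxeter_edge m i j}"

definition commutation_rels :: "nat \<Rightarrow> (nat \<Rightarrow> nat \<Rightarrow> enat) \<Rightarrow> (nat word \<times> nat word) set" where
  "commutation_rels n m =
     {([(i, True), (j, True)], [(j, True), (i, True)]) | i j. i < n \<and> j < n \<and> m i j = 2}"

definition square_rels :: "nat \<Rightarrow> (nat word \<times> nat word) set" where
  "square_rels n = {([(i, True), (i, True)], []) | i. i < n}"

definition artin_group :: "nat \<Rightarrow> (nat \<Rightarrow> nat \<Rightarrow> enat) \<Rightarrow> nat word set monoid" where
  "artin_group n m = presented_group {..<n} (commutation_rels n m)"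

definition coxeter_group :: "nat \<Rightarrow> (nat \<Rightarrow> nat \<Rightarrow> enat) \<Rightarrow> nat word set monoid" where
  "coxeter_group n m = presented_group {..<n} (square_rels n \<union> commutation_rels n m)"

definition artin_gen :: "nat \<Rightarrow> (nat \<Rightarrow> nat \<Rightarrow> enat) \<Rightarrow> nat \<Rightarrow> nat word set" where
  "artin_gen n m = pres_gen {..<n} (commutation_rels n m)"

definition coxeter_gen :: "nat \<Rightarrow> (nat \<Rightarrow> nat \<Rightarrow> enat) \<Rightarrow> nat \<Rightarrow> nat word set" where
  "coxeter_gen n m = pres_gen {..<n} (square_rels n \<union> commutation_rels n m)"

definition artin_to_coxeter ::
    "nat \<Rightarrow> (nat \<Rightarrow> nat \<Rightarrow> enat) \<Rightarrow> nat word set \<Rightarrow> nat word set" where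
  "artin_to_coxeter n m = extend_hom (coxeter_group n m) (coxeter_gen n m)"

lemma coxeter_group_is_group: "group (coxeter_group n m)"
  by (simp add: coxeter_group_def presented_group_is_group)

lemma coxeter_gen_closed: "coxeter_gen n m \<in> {..<n} \<rightarrow> carrier (coxeter_group n m)"
  unfolding coxeter_gen_def coxeter_group_def pres_gen_def presented_group_carrier Pi_iff
  by (intro ballI bexI[of _ "[(_, True)]"]) auto

lemma coxeter_gen_commute:
  assumes "(x, y) \<in> commutation_rels n m"
  shows "word_eval (coxeter_group n m) (coxeter_gen n m) x
    = word_eval (coxeter_group n m) (coxeter_gen n m) y"
proof -
  interpret group "coxeter_group n m" by (rule coxeter_group_is_group)
  let ?R = "square_rels n \<union> commutation_rels n m"
  obtain i j where ij: "i < n" "j < n"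
      "x = [(i, True), (j, True)]" "y = [(j, True), (i, True)]"
    using assms by (auto simp: commutation_rels_def)
  then have "(x, y) \<in> word_rel {..<n} ?R"
    using word_rel.relation[of "[]" "{..<n}" "[]" x y ?R] assms by auto
  then have "word_rel {..<n} ?R `` {x} = word_rel {..<n} ?R `` {y}"
    by (rule equiv_class_eq[OF word_rel_equiv])
  moreover have "coxeter_gen n m i \<in> carrier (coxeter_group n m)"
      "coxeter_gen n m j \<in> carrier (coxeter_group n m)"
    using ij coxeter_gen_closed by auto
  ultimately show ?thesis
    using ij by (simp add: word_eval_def)
      (simp add: coxeter_gen_def coxeter_group_def pres_gen_def presented_group_mult)
qed

lemma artin_to_coxeter_hom: "artin_to_coxeter n m \<in> hom (artin_group n m) (coxeter_group n m)"
  unfolding artin_to_coxeter_def artin_group_def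
  by (rule extend_hom_in_hom[OF coxeter_group_is_group coxeter_gen_closed coxeter_gen_commute])

lemma artin_to_coxeter_gen:
  "i < n \<Longrightarrow> artin_to_coxeter n m (artin_gen n m i) = coxeter_gen n m i"
  unfolding artin_to_coxeter_def artin_gen_def
  by (rule extend_hom_gen[OF coxeter_group_is_group coxeter_gen_closed coxeter_gen_commute]) auto

section \<open>Abelianisation\<close>

abbreviation commutator_subgroup :: "('g, 'h) monoid_scheme \<Rightarrow> 'g set" where
  "commutator_subgroup G \<equiv> derived G (carrier G)"

definition abelianisation :: "('g, 'h) monoid_scheme \<Rightarrow> 'g set monoid" where
  "abelianisation G = G Mod commutator_subgroup G"

definition abelianisation_map :: "('g, 'h) monoid_scheme \<Rightarrow> 'g \<Rightarrow> 'g set" where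
  "abelianisation_map G g = commutator_subgroup G #>\<^bsub>G\<^esub> g"

section \<open>The integral generalised Burau representation\<close>

definition GL :: "'a::comm_ring_1 itself \<Rightarrow> nat \<Rightarrow> 'a mat monoid" where
  "GL T n = units_of (ring_mat T n ())"

definition burau_form :: "(nat \<Rightarrow> nat \<Rightarrow> enat) \<Rightarrow> nat \<Rightarrow> nat \<Rightarrow> int" where
  "burau_form m i j =
     (if m i j = \<infinity> \<and> i < j then - 2 else if m i j = \<infinity> \<and> i > j then 2 else 0)"

text \<open>The \<open>j\<close>-th column is the image of the \<open>j\<close>-th basis vector.\<close>

definition burau_mat :: "nat \<Rightarrow> (nat \<Rightarrow> nat \<Rightarrow> enat) \<Rightarrow> nat \<Rightarrow> int mat" where
  "burau_mat n m i =
     mat_of_cols n (map (\<lambda>j. unit_vec n j - burau_form m i j \<cdot>\<^sub>v unit_vec n i) [0..<n])"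

definition burau :: "nat \<Rightarrow> (nat \<Rightarrow> nat \<Rightarrow> enat) \<Rightarrow> nat word set \<Rightarrow> int mat" where
  "burau n m = extend_hom (GL TYPE(int) n) (burau_mat n m)"

lemma burau_mat_carrier: "burau_mat n m i \<in> carrier_mat n n"
  unfolding burau_mat_def by (rule mat_of_cols_carrier(1)[of n "map _ [0..<n]", simplified])

lemma burau_mat_index:
  "k < n \<Longrightarrow> j < n \<Longrightarrow> burau_mat n m i $$ (k, j) =
    (if k = j then 1 else 0) - (if k = i then burau_form m i j else 0)"
  by (simp add: burau_mat_def mat_of_cols_index unit_vec_def)

lemma burau_mat_apply:
  assumes "i < n" "j < n"
  shows "burau_mat n m i *\<^sub>v unit_vec n j = unit_vec n j - burau_form m i j \<cdot>\<^sub>v unit_vec n i"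
  using burau_mat_carrier[of n m i] assms
  by (intro eq_vecI) (auto simp: burau_mat_index)

lemma GL_is_group: "group (GL TYPE('a::comm_ring_1) n)"
proof -
  interpret ring "ring_mat TYPE('a) n ()" by (rule ring_mat)
  show ?thesis
    unfolding GL_def by (rule units_group)
qed

lemma burau_mat_mult_index:
  assumes "i < n" "j < n" "k < n" "l < n"
  shows "(burau_mat n m i * burau_mat n m j) $$ (k, l) =
    (if k = l then 1 else 0) - (if k = j then burau_form m j l else 0)
      - (if k = i then burau_form m i l else 0)
      + (if k = i then burau_form m i j * burau_form m j l else 0)"
proof -
  have "(burau_mat n m i * burau_mat n m j) $$ (k, l) =
      (\<Sum>p<n. burau_mat n m i $$ (k, p) * burau_mat n m j $$ (p, l))"
    using assms burau_mat_carrier[of n m i] burau_mat_carrier[of n m j]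
    by (auto simp: scalar_prod_def atLeast0LessThan)
  also have "\<dots> = (\<Sum>p<n. burau_mat n m i $$ (k, p) * (if p = l then 1 else 0))
      - (\<Sum>p<n. burau_mat n m i $$ (k, p) * (if p = j then burau_form m j l else 0))"
    using assms by (simp add: burau_mat_index right_diff_distrib sum_subtractf)
  also have "\<dots> = burau_mat n m i $$ (k, l) - burau_mat n m i $$ (k, j) * burau_form m j l"
    using assms by (simp add: if_distrib[of "\<lambda>x. _ * x"] cong: if_cong)
  finally show ?thesis
    using assms by (simp add: burau_mat_index left_diff_distrib del: index_mult_mat)
qed

lemma burau_mat_GL:
  assumes "i < n"
  shows "burau_mat n m i \<in> carrier (GL TYPE(int) n)"
proof -
  let ?B = "burau_mat n m i"
  let ?C = "2 \<cdot>\<^sub>m 1\<^sub>m n - ?B"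
  have B: "?B \<in> carrier_mat n n" by (rule burau_mat_carrier)
  have "burau_form m i i = 0" by (simp add: burau_form_def)
  then have BB: "?B * ?B = 2 \<cdot>\<^sub>m ?B - 1\<^sub>m n"
    using B assms by (intro eq_matI) (auto simp: burau_mat_mult_index burau_mat_index simp del: index_mult_mat(1))
  have C: "?C \<in> carrier_mat n n" using B by auto
  have "?C * ?B = 2 \<cdot>\<^sub>m 1\<^sub>m n * ?B - ?B * ?B"
    using B by (intro minus_mult_distrib_mat) auto
  also have "\<dots> = 1\<^sub>m n" unfolding BB using B by (intro eq_matI) auto
  finally have CB: "?C * ?B = 1\<^sub>m n" .
  have "?B * ?C = ?B * (2 \<cdot>\<^sub>m 1\<^sub>m n) - ?B * ?B"
    using B by (intro mult_minus_distrib_mat) auto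
  also have "\<dots> = 1\<^sub>m n" unfolding BB using B by (intro eq_matI) auto
  finally have "?B * ?C = 1\<^sub>m n" .
  then show ?thesis
    using B C CB by (auto simp: GL_def units_of_def Units_def ring_mat_simps)
qed

lemma burau_mat_commute:
  assumes "right_angled_coxeter n m" "(x, y) \<in> commutation_rels n m"
  shows "word_eval (GL TYPE(int) n) (burau_mat n m) x
    = word_eval (GL TYPE(int) n) (burau_mat n m) y"
proof -
  interpret group "GL TYPE(int) n" by (rule GL_is_group)
  obtain i j where ij: "i < n" "j < n" "m i j = 2"
      "x = [(i, True), (j, True)]" "y = [(j, True), (i, True)]"
    using assms(2) by (auto simp: commutation_rels_def)
  have "m j i = 2"
    using assms(1) ij by (auto simp: right_angled_coxeter_def)
  then have "burau_form m i j = 0" "burau_form m j i = 0"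
    using ij by (auto simp: burau_form_def)
  then have "burau_mat n m i * burau_mat n m j = burau_mat n m j * burau_mat n m i"
    using burau_mat_carrier[of n m i] burau_mat_carrier[of n m j] ij
    by (intro eq_matI) (auto simp: burau_mat_mult_index simp del: index_mult_mat(1))
  then show ?thesis
    using ij burau_mat_GL[of i n m] burau_mat_GL[of j n m]
    by (simp add: word_eval_def) (simp add: GL_def units_of_def ring_mat_simps)
qed

lemma burau_hom:
  assumes "right_angled_coxeter n m"
  shows "burau n m \<in> hom (artin_group n m) (GL TYPE(int) n)"
  unfolding burau_def artin_group_def
  by (rule extend_hom_in_hom[OF GL_is_group _ burau_mat_commute[OF assms]])
    (auto intro: burau_mat_GL)

lemma burau_gen:
  assumes "right_angled_coxeter n m" "i < n"
  shows "burau n m (artin_gen n m i) = burau_mat n m i"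
  unfolding burau_def artin_gen_def
  by (rule extend_hom_gen[OF GL_is_group _ burau_mat_commute[OF assms(1)]])
    (use assms in \<open>auto intro: burau_mat_GL\<close>)

text \<open>The type \<open>4\<close> is the ring of integers modulo 4, and \<open>of_int\<close> is reduction modulo 4.\<close>

definition reduce_mod4 :: "int mat \<Rightarrow> 4 mat" where
  "reduce_mod4 = map_mat of_int"

definition artin_level4 :: "nat \<Rightarrow> (nat \<Rightarrow> nat \<Rightarrow> enat) \<Rightarrow> nat word set set" where
  "artin_level4 n m = kernel (artin_group n m) (GL TYPE(4) n) (reduce_mod4 \<circ> burau n m)"

end

theory Submission
  imports Defs
begin

text \<open>Both kernels consist of the classes of words in which every generator occurs (with exponent
  \<open>1\<close> or \<open>-1\<close>) an even number of times. On the Coxeter side the abelianisation is an elementary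
  abelian 2-group, and the parity of the number of occurrences of a fixed generator is a
  well-defined homomorphism. On the Burau side each generator acts as \<open>1 - E i\<close> with all entries of
  \<open>E i\<close> even; products \<open>E i * E j\<close> vanish modulo 4 and \<open>E i = - E i\<close> modulo 4, so a word acts as
  \<open>1\<close> plus the sum of the \<open>E i\<close>, each taken with the number of occurrences of \<open>i\<close>. As vertex \<open>i\<close> has
  positive degree, \<open>E i\<close> is nonzero modulo 4, so triviality means that all these numbers are even.\<close>

section \<open>Evaluation of words in groups\<close>

lemma word_eval_Nil [simp]: "word_eval G f [] = \<one>\<^bsub>G\<^esub>"
  by (simp add: word_eval_def)

lemma word_eval_Cons:
  "word_eval G f ((s, b) # x) = (if b then f s else inv\<^bsub>G\<^esub> f s) \<otimes>\<^bsub>G\<^esub> word_eval G f x"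
  by (simp add: word_eval_def)

lemma word_eval_hom:
  assumes "group_hom G H h" "f \<in> S \<rightarrow> carrier G" "x \<in> words S"
  shows "h (word_eval G f x) = word_eval H (h \<circ> f) x"
proof -
  interpret group_hom G H h by fact
  show ?thesis
    using assms(3)
  proof (induction x)
    case (Cons a x)
    obtain s b where a: "a = (s, b)" by force
    have "word_eval G f x \<in> carrier G"
      using Cons.hyps by (intro word_eval_closed[OF G.group_axioms assms(2)]) auto
    moreover have "f s \<in> carrier G"
      using Cons.hyps a assms(2) by auto
    ultimately show ?case
      using Cons.IH a by (simp add: word_eval_Cons)
  qed simp
qed

text \<open>Commutativity lets the letters be collected by generator. An involution is its own
  inverse, so signs do not matter and only the parity of each count survives.\<close>

lemma (in comm_group) word_eval_involutions:
  assumes "finite S" "f \<in> S \<rightarrow> carrier G" "\<And>s. s \<in> S \<Longrightarrow> f s \<otimes> f s = \<one>" "x \<in> words S"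
  shows "word_eval G f x = (\<Otimes>s\<in>S. if odd (count_list (map fst x) s) then f s else \<one>)"
  using assms(4)
proof (induction x)
  case (Cons a x)
  obtain s b where a: "a = (s, b)" by force
  have s: "s \<in> S" using Cons.hyps a by auto
  let ?g = "\<lambda>x j. if odd (count_list (map fst x) j) then f j else \<one>"
  have fj: "f j \<in> carrier G" if "j \<in> S" for j
    using assms(2) that by auto
  have "(\<Otimes>j\<in>S. ?g (a # x) j) = (\<Otimes>j\<in>S. (if s = j then f j else \<one>) \<otimes> ?g x j)"
    using fj assms(3) a by (intro finprod_cong') auto
  also have "\<dots> = (\<Otimes>j\<in>S. if s = j then f j else \<one>) \<otimes> (\<Otimes>j\<in>S. ?g x j)"
    using fj by (intro finprod_multf) auto
  also have "(\<Otimes>j\<in>S. if s = j then f j else \<one>) = f s"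
    using finprod_singleton[OF s assms(1,2)] .
  finally have "(\<Otimes>j\<in>S. ?g (a # x) j) = f s \<otimes> (\<Otimes>j\<in>S. ?g x j)" .
  moreover have "inv (f s) = f s"
    using fj s assms(3) by (intro inv_equality) auto
  ultimately show ?case
    using Cons.IH a by (simp add: word_eval_Cons)
qed simp

section \<open>The abelianisation of a right-angled Coxeter group\<close>

text \<open>The group of order 2 with exclusive or as addition. Taking truth values as elements lets
  the value of a word be read directly as a statement about parity.\<close>

definition parity_group :: "bool monoid" where
  "parity_group = \<lparr>carrier = UNIV, monoid.mult = (\<noteq>), one = False\<rparr>"

lemma parity_group_comm_group: "comm_group parity_group"
  by (rule comm_groupI) (auto simp: parity_group_def)

lemma word_eval_parity_group:
  "word_eval parity_group (\<lambda>j. j = i) x \<longleftrightarrow> odd (count_list (map fst x) i)"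
proof (induction x)
  case (Cons a x)
  interpret comm_group parity_group by (rule parity_group_comm_group)
  have "inv\<^bsub>parity_group\<^esub> b = b" for b
    by (intro inv_equality) (auto simp: parity_group_def)
  then show ?case
    using Cons by (cases a) (auto simp: word_eval_Cons parity_group_def)
qed (simp add: parity_group_def)

lemma coxeter_gen_square:
  assumes "i < n"
  shows "coxeter_gen n m i \<otimes>\<^bsub>coxeter_group n m\<^esub> coxeter_gen n m i = \<one>\<^bsub>coxeter_group n m\<^esub>"
proof -
  let ?R = "square_rels n \<union> commutation_rels n m"
  have "([(i, True), (i, True)], []) \<in> word_rel {..<n} ?R"
    using word_rel.relation[of "[]" "{..<n}" "[]" "[(i, True), (i, True)]" "[]" ?R] assms
    by (auto simp: square_rels_def)
  then have "word_rel {..<n} ?R `` {[(i, True), (i, True)]} = word_rel {..<n} ?R `` {[]}"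
    by (rule equiv_class_eq[OF word_rel_equiv])
  then show ?thesis
    using assms
    by (simp add: coxeter_gen_def coxeter_group_def pres_gen_def presented_group_mult
        presented_group_one)
qed

text \<open>A homomorphism to an abelian group of order 2 reads off the parity for each single
  generator and kills commutators. Conversely, the quotient by the commutator subgroup is abelian
  and the generators become involutions there, so even counts give the trivial coset.\<close>

lemma coxeter_word_in_commutator_subgroup_iff:
  assumes "x \<in> words {..<n}"
  shows "word_eval (coxeter_group n m) (coxeter_gen n m) x
      \<in> commutator_subgroup (coxeter_group n m)
    \<longleftrightarrow> (\<forall>i<n. even (count_list (map fst x) i))"
    (is "?w \<in> ?D \<longleftrightarrow> _")
proof
  let ?W = "coxeter_group n m" and ?R = "square_rels n \<union> commutation_rels n m"
  interpret W: group ?W by (rule coxeter_group_is_group)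
  interpret P: comm_group parity_group by (rule parity_group_comm_group)
  {
    assume w: "?w \<in> ?D"
    show "\<forall>i<n. even (count_list (map fst x) i)"
    proof (intro allI impI)
      fix i assume "i < n"
      let ?h = "extend_hom parity_group (\<lambda>j. j = i)"
      \<comment> \<open>A square relation changes the count of \<open>i\<close> by 0 or 2, and a
        commutation relation only swaps letters, so parity descends to the Coxeter group.\<close>
      have R: "word_eval parity_group (\<lambda>j. j = i) y = word_eval parity_group (\<lambda>j. j = i) z"
        if "(y, z) \<in> ?R" for y z
        using that by (auto simp: word_eval_parity_group square_rels_def commutation_rels_def
            split: if_splits)
      have f: "(\<lambda>j. j = i) \<in> {..<n} \<rightarrow> carrier parity_group"
        by (simp add: parity_group_def)
      have "group_hom ?W parity_group ?h"
        using extend_hom_in_hom[where R = ?R, OF P.group_axioms f R] W.group_axioms P.group_axioms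
        by (simp add: group_hom_def group_hom_axioms_def coxeter_group_def)
      then interpret h: group_hom ?W parity_group ?h .
      have "?h ?w = word_eval parity_group (?h \<circ> coxeter_gen n m) x"
        by (rule word_eval_hom[OF h.group_hom_axioms coxeter_gen_closed assms])
      also have "\<dots> = word_eval parity_group (\<lambda>j. j = i) x"
        using assms
      proof (induction x)
        case (Cons a x)
        then show ?case
          using extend_hom_gen[where R = ?R, OF P.group_axioms f R, of "fst a"]
          by (cases a) (auto simp: word_eval_Cons coxeter_gen_def)
      qed simp
      finally have "?h ?w \<longleftrightarrow> odd (count_list (map fst x) i)"
        by (simp add: word_eval_parity_group)
      \<comment> \<open>A homomorphism maps the derived subgroup onto the derived subgroup of its
        image, which is trivial in an abelian group.\<close>
      moreover have "?h ?w \<in> derived parity_group (?h ` carrier ?W)"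
        using h.derived_img[of "carrier ?W"] w by blast
      then have "\<not> ?h ?w"
        using P.derived_eq_singleton[of "?h ` carrier ?W"] by (auto simp: parity_group_def)
      ultimately show "even (count_list (map fst x) i)" by simp
    qed
  }
  {
    assume even: "\<forall>i<n. even (count_list (map fst x) i)"
    interpret D: normal ?D ?W by (rule W.derived_self_is_normal)
    interpret Q: comm_group "?W Mod ?D" by (rule W.derived_quot_is_comm_group)
    let ?q = "\<lambda>g. ?D #>\<^bsub>?W\<^esub> g"
    interpret q: group_hom ?W "?W Mod ?D" ?q
      by unfold_locales (rule D.r_coset_hom_Mod)
    note gen = coxeter_gen_closed[of n m]
    have "?q ?w = word_eval (?W Mod ?D) (?q \<circ> coxeter_gen n m) x"
      by (rule word_eval_hom[OF q.group_hom_axioms gen assms])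
    also have "\<dots> = finprod (?W Mod ?D) (\<lambda>s. if odd (count_list (map fst x) s)
        then (?q \<circ> coxeter_gen n m) s else \<one>\<^bsub>?W Mod ?D\<^esub>) {..<n}"
    proof (rule Q.word_eval_involutions[OF _ _ _ assms])
      fix s assume "s \<in> {..<n}"
      then show "(?q \<circ> coxeter_gen n m) s \<otimes>\<^bsub>?W Mod ?D\<^esub> (?q \<circ> coxeter_gen n m) s = \<one>\<^bsub>?W Mod ?D\<^esub>"
        using gen coxeter_gen_square[of s n m] q.hom_mult[of "coxeter_gen n m s" "coxeter_gen n m s"]
        by auto
    next
      show "?q \<circ> coxeter_gen n m \<in> {..<n} \<rightarrow> carrier (?W Mod ?D)"
        using gen q.hom_closed unfolding Pi_iff comp_apply by blast
    qed simp
    also have "\<dots> = \<one>\<^bsub>?W Mod ?D\<^esub>"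
      using even by (intro Q.finprod_one_eqI) auto
    finally have "?D #>\<^bsub>?W\<^esub> ?w = ?D" by simp
    then show "?w \<in> ?D"
      using W.coset_join1 word_eval_closed[OF W.group_axioms gen assms] D.subgroup_axioms by blast
  }
qed

section \<open>The Burau representation modulo 4\<close>

lemma of_int_mod4_eq_iff: "(of_int a :: 4) = of_int b \<longleftrightarrow> 4 dvd a - b"
proof -
  have "(of_int (a - b) :: 4) = 0 \<longleftrightarrow> int CHAR(4) dvd a - b"
    by (rule of_int_eq_0_iff_char_dvd)
  then show ?thesis by simp
qed

lemma GL_simps:
  "\<one>\<^bsub>GL T n\<^esub> = 1\<^sub>m n" "A \<otimes>\<^bsub>GL T n\<^esub> B = A * B"
  by (simp_all add: GL_def units_of_def ring_mat_simps)

lemma GL_carrier_mat: "A \<in> carrier (GL T n) \<Longrightarrow> A \<in> carrier_mat n n"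
  by (auto simp: GL_def units_of_def Units_def ring_mat_simps)

text \<open>Since \<open>burau_form m i i = 0\<close>, the matrix \<open>E i\<close> squares to
  zero, so the inverse of \<open>1 - E i\<close> is \<open>1 + E i\<close>.\<close>

lemma burau_mat_inv_index:
  assumes "i < n" "k < n" "j < n"
  shows "(inv\<^bsub>GL TYPE(int) n\<^esub> burau_mat n m i) $$ (k, j) =
    (if k = j then 1 else 0) + (if k = i then burau_form m i j else 0)"
proof -
  interpret group "GL TYPE(int) n" by (rule GL_is_group)
  let ?B = "burau_mat n m i" and ?I = "inv\<^bsub>GL TYPE(int) n\<^esub> burau_mat n m i"
  have B: "?B \<in> carrier (GL TYPE(int) n)" by (rule burau_mat_GL[OF assms(1)])
  then have I: "?I \<in> carrier_mat n n" by (intro GL_carrier_mat[where T = "TYPE(int)"] inv_closed)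
  have "?I * ?B = 1\<^sub>m n"
    using l_inv[OF B] by (simp add: GL_simps)
  then have IB: "(?I * ?B) $$ (k, l) = (if k = l then 1 else 0)" if "l < n" for l
    using assms that by simp
  have *: "?I $$ (k, l) - ?I $$ (k, i) * burau_form m i l = (if k = l then 1 else 0)"
    if l: "l < n" for l
  proof -
    have "(?I * ?B) $$ (k, l) = (\<Sum>p<n. ?I $$ (k, p) * ?B $$ (p, l))"
      using I burau_mat_carrier[of n m i] assms l by (auto simp: scalar_prod_def atLeast0LessThan)
    also have "\<dots> = (\<Sum>p<n. ?I $$ (k, p) * (if p = l then 1 else 0))
        - (\<Sum>p<n. ?I $$ (k, p) * (if p = i then burau_form m i l else 0))"
      using l by (simp add: burau_mat_index right_diff_distrib sum_subtractf)
    also have "\<dots> = ?I $$ (k, l) - ?I $$ (k, i) * burau_form m i l"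
      using assms l by (simp add: if_distrib[of "\<lambda>x. _ * x"] cong: if_cong)
    finally show ?thesis using IB[OF l] by simp
  qed
  \<comment> \<open>Column \<open>i\<close> is solved first, as there the correction term in
    \<open>*\<close> vanishes; its entries then determine every other column.\<close>
  have "burau_form m i i = 0" by (simp add: burau_form_def)
  then have "?I $$ (k, i) = (if k = i then 1 else 0)"
    using *[OF assms(1)] by simp
  then show ?thesis
    using *[OF assms(3)] by (auto split: if_splits)
qed

lemma even_burau_form: "even (burau_form m i j)"
  by (simp add: burau_form_def)

text \<open>Row \<open>k\<close> of the sum of the \<open>E i\<close> comes from \<open>E k\<close>
  alone, so the count of \<open>k\<close> is the coefficient of that row. The plus sign serves
  generators and inverses alike, because an even number equals its negative modulo 4.\<close>

lemma burau_word_mod4: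
  assumes "x \<in> words {..<n}" "k < n" "l < n"
  shows "4 dvd word_eval (GL TYPE(int) n) (burau_mat n m) x $$ (k, l)
    - ((if k = l then 1 else 0) + int (count_list (map fst x) k) * burau_form m k l)"
  using assms
proof (induction x arbitrary: k l)
  case (Cons a x)
  interpret group "GL TYPE(int) n" by (rule GL_is_group)
  obtain s b where a: "a = (s, b)" by force
  then have s: "s < n" using Cons.hyps by auto
  let ?M = "word_eval (GL TYPE(int) n) (burau_mat n m) x"
  let ?A = "if b then burau_mat n m s else inv\<^bsub>GL TYPE(int) n\<^esub> burau_mat n m s"
  \<comment> \<open>The sign with which the letter \<open>(s, b)\<close> adds the form values to row
    \<open>s\<close> of the identity matrix.\<close>
  let ?e = "if b then - 1 else 1 :: int"
  let ?c = "\<lambda>k. int (count_list (map fst x) k)"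
  have M: "?M \<in> carrier_mat n n"
    using Cons.hyps burau_mat_GL
    by (intro GL_carrier_mat[where T = "TYPE(int)"] word_eval_closed[OF group_axioms, where S = "{..<n}"]) auto
  have A: "?A \<in> carrier_mat n n"
    using burau_mat_GL[OF s] by (intro GL_carrier_mat[where T = "TYPE(int)"]) auto
  have A_index: "?A $$ (k, p) = (if k = p then 1 else 0) + (if k = s then ?e * burau_form m s p else 0)"
    if "p < n" for p
    using that Cons.prems s by (simp add: burau_mat_index burau_mat_inv_index)
  have "(?A * ?M) $$ (k, l) = (\<Sum>p<n. ?A $$ (k, p) * ?M $$ (p, l))"
    using A M Cons.prems by (auto simp: scalar_prod_def atLeast0LessThan split del: if_split)
  also have "\<dots> = (\<Sum>p<n. (if k = p then ?M $$ (p, l) else 0)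
      + (if k = s then ?e * burau_form m s p * ?M $$ (p, l) else 0))"
  proof (rule sum.cong[OF HOL.refl])
    fix p assume "p \<in> {..<n}"
    then have "p < n" by simp
    show "?A $$ (k, p) * ?M $$ (p, l) = (if k = p then ?M $$ (p, l) else 0)
      + (if k = s then ?e * burau_form m s p * ?M $$ (p, l) else 0)"
      unfolding A_index[OF \<open>p < n\<close>] by (simp add: distrib_right)
  qed
  also have "\<dots> = ?M $$ (k, l) + (if k = s then ?e * (\<Sum>p<n. burau_form m s p * ?M $$ (p, l)) else 0)"
    using Cons.prems by (simp add: sum.distrib sum_distrib_left mult.assoc)
  finally have AM: "(?A * ?M) $$ (k, l) =
    ?M $$ (k, l) + (if k = s then ?e * (\<Sum>p<n. burau_form m s p * ?M $$ (p, l)) else 0)" .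
  \<comment> \<open>By the induction hypothesis and evenness of the form, \<open>?M\<close> is the
    identity modulo 2. The further even factor \<open>burau_form m s p\<close> makes the error
    vanish modulo 4; this is why the products \<open>E i * E j\<close> disappear.\<close>
  have "4 dvd burau_form m s p * ?M $$ (p, l) - burau_form m s p * (if p = l then 1 else 0)"
    if p: "p < n" for p
  proof -
    have "even (?M $$ (p, l) - ((if p = l then 1 else 0) + ?c p * burau_form m p l))"
      using Cons.IH[OF p \<open>l < n\<close>] by (rule dvd_trans[rotated]) simp
    moreover have "even (?c p * burau_form m p l)"
      using even_burau_form by simp
    ultimately have "even (?M $$ (p, l) - (if p = l then 1 else 0))"
      by (simp split del: if_split)
    then have "2 * 2 dvd burau_form m s p * (?M $$ (p, l) - (if p = l then 1 else 0))"
      by (intro mult_dvd_mono even_burau_form)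
    then show ?thesis by (simp add: right_diff_distrib)
  qed
  then have "4 dvd (\<Sum>p<n. burau_form m s p * ?M $$ (p, l) - burau_form m s p * (if p = l then 1 else 0))"
    by (intro dvd_sum) auto
  then have "4 dvd (\<Sum>p<n. burau_form m s p * ?M $$ (p, l)) - burau_form m s l"
    using \<open>l < n\<close> by (simp add: sum_subtractf if_distrib[of "\<lambda>x. _ * x"] cong: if_cong)
  \<comment> \<open>The sign \<open>?e\<close> is invisible modulo 4, as 2 and -2 agree
    there.\<close>
  moreover have "4 dvd ?e * burau_form m s l - burau_form m s l"
    using even_burau_form[of m s l] by (auto elim!: evenE)
  ultimately have "4 dvd ?e * ((\<Sum>p<n. burau_form m s p * ?M $$ (p, l)) - burau_form m s l)
      + (?e * burau_form m s l - burau_form m s l)"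
    by (intro dvd_add dvd_mult)
  then have "4 dvd ?e * (\<Sum>p<n. burau_form m s p * ?M $$ (p, l)) - burau_form m s l"
    by (simp add: right_diff_distrib split del: if_split)
  then have "4 dvd (if k = s then ?e * (\<Sum>p<n. burau_form m s p * ?M $$ (p, l)) else 0)
      - (if k = s then burau_form m s l else 0)"
    by simp
  \<comment> \<open>Only row \<open>s\<close> gains a copy of the form, matching the increase of the
    count of \<open>s\<close> by one.\<close>
  from dvd_add[OF Cons.IH[OF \<open>k < n\<close> \<open>l < n\<close>] this]
  have "4 dvd (?A * ?M) $$ (k, l)
      - ((if k = l then 1 else 0) + (?c k + (if k = s then 1 else 0)) * burau_form m k l)"
    unfolding AM by (simp add: algebra_simps split del: if_split) (auto simp: algebra_simps)
  then show ?case
    using a by (auto simp: word_eval_Cons GL_simps algebra_simps simp del: index_mult_mat)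
qed (simp add: GL_simps)

lemma four_dvd_mult_burau_form:
  assumes "coxeter_edge m i j"
  shows "4 dvd int c * burau_form m i j \<longleftrightarrow> even c"
proof -
  have "burau_form m i j = 2 \<or> burau_form m i j = - 2"
    using assms by (auto simp: burau_form_def coxeter_edge_def)
  then show ?thesis
    by auto presburger+
qed

text \<open>Modulo 4, triviality says that every count annihilates its row of the form. Positive
  degree puts an entry 2 or -2 into each row, and that entry detects the parity of the
  count.\<close>

lemma burau_word_trivial_mod4_iff:
  assumes "\<forall>i<n. coxeter_degree n m i \<noteq> 0" "x \<in> words {..<n}"
  shows "reduce_mod4 (word_eval (GL TYPE(int) n) (burau_mat n m) x) = 1\<^sub>m n
    \<longleftrightarrow> (\<forall>i<n. even (count_list (map fst x) i))"
proof -
  let ?M = "word_eval (GL TYPE(int) n) (burau_mat n m) x"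
  let ?c = "count_list (map fst x)"
  have M: "?M \<in> carrier_mat n n"
    using assms(2) burau_mat_GL
    by (intro GL_carrier_mat[where T = "TYPE(int)"] word_eval_closed[OF GL_is_group, where S = "{..<n}"]) auto
  have "reduce_mod4 ?M = 1\<^sub>m n \<longleftrightarrow>
      (\<forall>k<n. \<forall>l<n. of_int (?M $$ (k, l)) = (of_int (if k = l then 1 else 0) :: 4))"
    using M by (auto simp: reduce_mod4_def mat_eq_iff)
  also have "\<dots> \<longleftrightarrow> (\<forall>k<n. \<forall>l<n. 4 dvd ?M $$ (k, l) - (if k = l then 1 else 0))"
    by (simp only: of_int_mod4_eq_iff)
  also have "\<dots> \<longleftrightarrow> (\<forall>k<n. \<forall>l<n. 4 dvd int (?c k) * burau_form m k l)"
  proof (intro all_cong)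
    fix k l assume "k < n" "l < n"
    from burau_word_mod4[OF assms(2) this, of m]
    show "4 dvd ?M $$ (k, l) - (if k = l then 1 else 0) \<longleftrightarrow> 4 dvd int (?c k) * burau_form m k l"
      by presburger
  qed
  also have "\<dots> \<longleftrightarrow> (\<forall>i<n. even (?c i))"
  proof (intro all_cong iffI allI impI)
    fix k assume "k < n" and *: "\<forall>l<n. 4 dvd int (?c k) * burau_form m k l"
    then have "{j. j < n \<and> coxeter_edge m k j} \<noteq> {}"
      using assms(1) by (force simp: coxeter_degree_def)
    then obtain j where "j < n" "coxeter_edge m k j" by blast
    then show "even (?c k)"
      using * four_dvd_mult_burau_form by blast
  next
    fix k l assume "even (?c k)"
    then have "2 * 2 dvd int (?c k) * burau_form m k l"
      by (intro mult_dvd_mono even_burau_form) simp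
    then show "4 dvd int (?c k) * burau_form m k l" by simp
  qed
  finally show ?thesis .
qed

section \<open>Comparison of the two kernels\<close>

theorem theorem7p7:
  fixes n :: nat and m :: "nat \<Rightarrow> nat \<Rightarrow> enat"
  assumes "right_angled_coxeter n m"
    and "\<forall>i<n. coxeter_degree n m i \<noteq> 0"
  shows "artin_level4 n m =
    kernel (artin_group n m) (abelianisation (coxeter_group n m))
      (abelianisation_map (coxeter_group n m) \<circ> artin_to_coxeter n m)"
proof -
  let ?W = "coxeter_group n m"
  interpret W: group ?W by (rule coxeter_group_is_group)
  have D: "subgroup (commutator_subgroup ?W) ?W"
    by (simp add: W.derived_is_subgroup)
  \<comment> \<open>For a word representing \<open>X\<close>, both conditions reduce to the same
    one: every generator occurs an even number of times.\<close>
  have "reduce_mod4 (burau n m X) = 1\<^sub>m n \<longleftrightarrow>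
      commutator_subgroup ?W #>\<^bsub>?W\<^esub> artin_to_coxeter n m X = commutator_subgroup ?W"
    if X: "X \<in> carrier (artin_group n m)" for X
  proof -
    obtain x where x: "x \<in> words {..<n}" "X = word_rel {..<n} (commutation_rels n m) `` {x}"
      using X unfolding artin_group_def presented_group_carrier by blast
    have burau: "burau n m X = word_eval (GL TYPE(int) n) (burau_mat n m) x"
      unfolding burau_def x(2)
      by (rule extend_hom_class[OF GL_is_group _ burau_mat_commute[OF assms(1)] x(1)])
        (auto intro: burau_mat_GL)
    let ?w = "word_eval ?W (coxeter_gen n m) x"
    have coxeter: "artin_to_coxeter n m X = ?w"
      unfolding artin_to_coxeter_def x(2)
      by (rule extend_hom_class[OF coxeter_group_is_group coxeter_gen_closed coxeter_gen_commute x(1)])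
    have "?w \<in> carrier ?W"
      by (rule word_eval_closed[OF coxeter_group_is_group coxeter_gen_closed x(1)])
    then have "commutator_subgroup ?W #>\<^bsub>?W\<^esub> ?w = commutator_subgroup ?W
        \<longleftrightarrow> ?w \<in> commutator_subgroup ?W"
      using W.coset_join1 W.coset_join2 D by blast
    then show ?thesis
      unfolding burau coxeter
      by (simp add: burau_word_trivial_mod4_iff[OF assms(2) x(1)]
          coxeter_word_in_commutator_subgroup_iff[OF x(1)])
  qed
  then show ?thesis
    by (auto simp: artin_level4_def kernel_def GL_simps abelianisation_def abelianisation_map_def)
qed

end
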